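(* Suppose $(\eta_n)$ is a sequence of positive real numbers with $\eta_n\to0$. For every sequence $a_n$ of nonnegative real numbers we have, with $E_{H,n}=[\tilde\theta_H-\hat\sigma a_n,\tilde\theta_H+\hat\sigma a_n]$ and $C_{H,n}=[\hat\theta_H-a_n,\hat\theta_H+a_n]$, that $$\inf_{\theta\in\mathbb{R}}P_{n,\theta}(\theta\in E_{H,n})-\inf_{\theta\in\mathbb{R}}P_{n,\theta}(\theta\in C_{H,n})\to 0$$ as $n\to\infty$. The analogous results hold for the corresponding open and half-open intervals (i.e., when both $E_{H,n}$ and $C_{H,n}$ are replaced by the open, or by the left-open or right-open half-open, intervals with the same endpoints).
   Context: For $n\ge2$ the data $y_1,\dots,y_n$ are i.i.d. $N(\theta,1)$ with $\theta\in\mathbb{R}$; $P_{n,\theta}$ denotes the distribution of the sample when $\theta$ is the true parameter (true variance $\sigma^2=1$). Let $\bar y=n^{-1}\sum_{i=1}^n y_i$, $\hat\sigma^2=(n-1)^{-1}\sum_{i=1}^n(y_i-\bar y)^2$, $\hat\sigma=\sqrt{\hat\sigma^2}$. The feasible hard-thresholding estimator is $\tilde\theta_H=\bar y\,\mathbf{1}(|\bar y|>\hat\sigma\eta_n)$ and its known-variance version is $\hat\theta_H=\bar y\,\mathbf{1}(|\bar y|>\eta_n)$. *)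

theory Defs
  imports "HOL-Probability.Probability"
begin

text \<open>A sample of size \<open>n\<close> is a point \<open>y\<close> of \<open>{1..n} \<rightarrow>\<^sub>E \<real>\<close>; the law of the sample is the
  \<open>n\<close>-fold product of the normal distribution with mean \<open>\<theta>\<close> and variance \<open>1\<close>.\<close>

definition sample_law :: "nat \<Rightarrow> real \<Rightarrow> (nat \<Rightarrow> real) measure" where
  "sample_law n \<theta> =
     (\<Pi>\<^sub>M i\<in>{1..n}. density lborel (\<lambda>x. ennreal (normal_density \<theta> 1 x)))"

definition sample_mean :: "nat \<Rightarrow> (nat \<Rightarrow> real) \<Rightarrow> real" where
  "sample_mean n y = (\<Sum>i=1..n. y i) / real n"

definition sample_variance :: "nat \<Rightarrow> (nat \<Rightarrow> real) \<Rightarrow> real" where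
  "sample_variance n y = (\<Sum>i=1..n. (y i - sample_mean n y)\<^sup>2) / (real n - 1)"

definition sample_sd :: "nat \<Rightarrow> (nat \<Rightarrow> real) \<Rightarrow> real" where
  "sample_sd n y = sqrt (sample_variance n y)"

definition hard_threshold_known :: "nat \<Rightarrow> real \<Rightarrow> (nat \<Rightarrow> real) \<Rightarrow> real" where
  "hard_threshold_known n \<eta> y =
     (if \<bar>sample_mean n y\<bar> > \<eta> then sample_mean n y else 0)"

definition hard_threshold_feasible :: "nat \<Rightarrow> real \<Rightarrow> (nat \<Rightarrow> real) \<Rightarrow> real" where
  "hard_threshold_feasible n \<eta> y =
     (if \<bar>sample_mean n y\<bar> > sample_sd n y * \<eta> then sample_mean n y else 0)"

text \<open>The argument \<open>ivl\<close> sends a lower and an upper endpoint to the interval between them, so that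
  it fixes which endpoints are included: \<open>atLeastAtMost\<close>, \<open>greaterThanLessThan\<close>,
  \<open>greaterThanAtMost\<close> or \<open>atLeastLessThan\<close>.\<close>

definition interval_known ::
    "(real \<Rightarrow> real \<Rightarrow> real set) \<Rightarrow> nat \<Rightarrow> real \<Rightarrow> real \<Rightarrow> (nat \<Rightarrow> real) \<Rightarrow> real set" where
  "interval_known ivl n \<eta> a y =
     ivl (hard_threshold_known n \<eta> y - a) (hard_threshold_known n \<eta> y + a)"

definition interval_feasible ::
    "(real \<Rightarrow> real \<Rightarrow> real set) \<Rightarrow> nat \<Rightarrow> real \<Rightarrow> real \<Rightarrow> (nat \<Rightarrow> real) \<Rightarrow> real set" where
  "interval_feasible ivl n \<eta> a y =
     ivl (hard_threshold_feasible n \<eta> y - sample_sd n y * a)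
         (hard_threshold_feasible n \<eta> y + sample_sd n y * a)"

definition inf_coverage :: "nat \<Rightarrow> ((nat \<Rightarrow> real) \<Rightarrow> real set) \<Rightarrow> real" where
  "inf_coverage n C = (INF \<theta>\<in>(UNIV :: real set). \<P>(y in sample_law n \<theta>. \<theta> \<in> C y))"

end

theory Submission
  imports Defs
begin

text \<open>
  Both intervals are instances of one construction: threshold the mean at \<open>s \<eta>\<close> and use the
  half-length \<open>s a\<close>, where the scale \<open>s\<close> is the sample standard deviation for the feasible interval
  and \<open>1\<close> for the interval with known variance.  It therefore suffices to find one deterministic
  sequence that approximates the infimal coverage for every scale that satisfies
  \<open>\<bar>s - 1\<bar> \<le> K / \<surd>n\<close> with probability close to \<open>1\<close>, uniformly in \<open>\<theta>\<close>.  With \<open>\<Phi>\<close> the standard normal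
  distribution function, this sequence is \<open>max 0 (\<Phi>(\<surd>n a) - \<Phi>(\<surd>n (\<eta> - a)))\<close>.

  The formula comes from the parameters just above \<open>a\<close>.  The value \<open>0\<close> of the estimator then just
  fails to cover \<open>\<theta>\<close>, so that coverage means that the mean \<open>m\<close> exceeds the threshold \<open>\<eta>\<close> and lies
  within \<open>a\<close> of \<open>\<theta>\<close>; with \<open>\<theta> = a\<close> in the limit, these are the conditions
  \<open>\<eta> - a < m - \<theta> \<le> a\<close>.  No other parameter does worse: for \<open>\<theta> \<ge> 0\<close> the same conditions
  on \<open>m - \<theta>\<close> always imply coverage, and negative parameters are the mirror image.  Since
  \<open>\<surd>n (m - \<theta>)\<close> is standard normal, the formula follows.

  On the event \<open>\<bar>s - 1\<bar> \<le> K / \<surd>n\<close> the random scale moves the two bounds for \<open>\<surd>n (m - \<theta>)\<close> by at most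
  \<open>K (\<eta> + a)\<close>; the exceptional event only costs its probability.  As \<open>\<Phi>\<close> is Lipschitz, the shift is
  harmless when \<open>\<eta>\<close> and \<open>a\<close> are small.  When \<open>a\<close> is bounded away from \<open>0\<close>, the arguments of \<open>\<Phi>\<close>
  tend to \<open>\<plusminus>\<infinity>\<close>, because \<open>\<eta>\<close> tends to \<open>0\<close>, and all quantities are close to \<open>1\<close>.
  A threshold \<open>\<delta>\<close> for \<open>a\<close>, chosen small relative to \<open>1 / K\<close>, separates the two regimes, so that the
  sequence \<open>a\<close> may be arbitrary (\<open>inf_coverage_asymptotics\<close>).

  That the sample standard deviation is within \<open>K / \<surd>n\<close> of \<open>1\<close> with high probability
  (\<open>sample_sd_tight\<close>) is Chebyshev's inequality for the sum of the centred squared errors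
  \<open>(y i - \<theta>)\<^sup>2 - 1\<close>, whose variance is \<open>2 n\<close>.
\<close>

section \<open>The standard normal distribution function\<close>

abbreviation Phi :: "real \<Rightarrow> real" where
  "Phi \<equiv> cdf std_normal_distribution"

lemma Phi_mono: "x \<le> y \<Longrightarrow> Phi x \<le> Phi y"
proof -
  interpret real_distribution std_normal_distribution by (rule real_dist_normal_dist)
  show "x \<le> y \<Longrightarrow> Phi x \<le> Phi y" by (rule cdf_nondecreasing)
qed

lemma Phi_bounds: "0 \<le> Phi x" "Phi x \<le> 1"
proof -
  interpret real_distribution std_normal_distribution by (rule real_dist_normal_dist)
  show "0 \<le> Phi x" "Phi x \<le> 1" by (auto simp: cdf_def)
qed

lemma Phi_tails:
  assumes "\<epsilon> > 0"
  obtains T where "Phi (-T) \<le> \<epsilon>" "Phi T \<ge> 1 - \<epsilon>"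
proof -
  interpret real_distribution std_normal_distribution by (rule real_dist_normal_dist)
  have "eventually (\<lambda>x. Phi x > 1 - \<epsilon>) at_top"
    using cdf_lim_at_top_prob assms by (intro order_tendstoD) auto
  moreover have "eventually (\<lambda>x. Phi x < \<epsilon>) at_bot"
    using cdf_lim_at_bot assms by (intro order_tendstoD) auto
  then have "eventually (\<lambda>x. Phi (-x) < \<epsilon>) at_top"
    using filterlim_uminus_at_bot_at_top by (rule eventually_compose_filterlim)
  ultimately have "eventually (\<lambda>x. Phi x > 1 - \<epsilon> \<and> Phi (-x) < \<epsilon>) at_top"
    by eventually_elim simp
  then obtain T where "Phi T > 1 - \<epsilon> \<and> Phi (-T) < \<epsilon>"
    using eventually_happens'[OF trivial_limit_at_top_linorder] by blast
  then show ?thesis by (intro that[of T]) auto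
qed

lemma measure_std_normal_interval:
  assumes "l \<le> u"
  shows "measure std_normal_distribution {l..u} = Phi u - Phi l"
    and "measure std_normal_distribution {l<..<u} = Phi u - Phi l"
proof -
  interpret real_distribution std_normal_distribution by (rule real_dist_normal_dist)
  have ne: "AE x in std_normal_distribution. x \<noteq> c" for c
    using AE_lborel_singleton[of c] by (auto simp: AE_density elim: eventually_mono)
  have oc: "measure std_normal_distribution {l<..u} = Phi u - Phi l"
    using cdf_diff_eq[of l u] assms by (cases "l = u") auto
  have "measure std_normal_distribution {l..u} = measure std_normal_distribution {l<..u}"
    using ne[of l] by (intro finite_measure_eq_AE) (auto elim!: eventually_mono)
  moreover have "measure std_normal_distribution {l<..<u} = measure std_normal_distribution {l<..u}"
    using ne[of u] by (intro finite_measure_eq_AE) (auto elim!: eventually_mono)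
  ultimately show "measure std_normal_distribution {l..u} = Phi u - Phi l"
    and "measure std_normal_distribution {l<..<u} = Phi u - Phi l"
    using oc by simp_all
qed

text \<open>The standard normal density is bounded by \<open>1 / \<surd>(2 \<pi>)\<close>, hence by \<open>1\<close>.\<close>

lemma Phi_diff_le:
  assumes "u \<le> v"
  shows "Phi v - Phi u \<le> v - u"
proof -
  interpret real_distribution std_normal_distribution by (rule real_dist_normal_dist)
  have le1: "std_normal_density x \<le> 1" for x :: real
  proof -
    have "(1 / sqrt (2 * pi)) * exp (- x\<^sup>2 / 2) \<le> 1 * 1"
      using pi_gt3 by (intro mult_mono) auto
    then show ?thesis by (simp add: std_normal_density_def)
  qed
  have "emeasure std_normal_distribution {u..v}
      = (\<integral>\<^sup>+x. ennreal (std_normal_density x) * indicator {u..v} x \<partial>lborel)"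
    by (subst emeasure_density) auto
  also have "\<dots> \<le> (\<integral>\<^sup>+x. indicator {u..v} x \<partial>lborel)"
    using le1 by (intro nn_integral_mono) (auto simp: indicator_def)
  also have "\<dots> = ennreal (v - u)"
    using assms by simp
  finally have "measure std_normal_distribution {u..v} \<le> v - u"
    using assms by (simp add: emeasure_eq_measure)
  then show ?thesis using measure_std_normal_interval(1)[OF assms] by simp
qed

lemma (in prob_space) distributed_std_normal_prob:
  assumes X: "distributed M lborel X std_normal_density" and B: "B \<in> sets borel"
  shows "prob {x \<in> space M. X x \<in> B} = measure std_normal_distribution B"
proof -
  have [measurable]: "X \<in> measurable M borel"
    using distributed_measurable[OF X] by simp
  have "measure std_normal_distribution B = measure (distr M lborel X) B"
    using distributed_distr_eq_density[OF X] by simp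
  also have "\<dots> = prob {x \<in> space M. X x \<in> B}"
    using B by (subst measure_distr) (auto intro!: arg_cong[where f=prob])
  finally show ?thesis by simp
qed

section \<open>The Gaussian sample and its mean\<close>

lemma prob_space_sample_law: "prob_space (sample_law n \<theta>)"
  unfolding sample_law_def by (intro prob_space_PiM prob_space_normal_density) simp

lemma measurable_sample_component[measurable]:
  "i \<in> {1..n} \<Longrightarrow> (\<lambda>y. y i) \<in> borel_measurable (sample_law n \<theta>)"
proof -
  assume i: "i \<in> {1..n}"
  have "(\<lambda>y. y i) \<in> measurable (sample_law n \<theta>) (density lborel (\<lambda>x. ennreal (normal_density \<theta> 1 x)))"
    unfolding sample_law_def using i by (rule measurable_component_singleton)
  also have "measurable (sample_law n \<theta>) (density lborel (\<lambda>x. ennreal (normal_density \<theta> 1 x)))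
      = borel_measurable (sample_law n \<theta>)"
    by (intro measurable_cong_sets) auto
  finally show ?thesis .
qed

lemma measurable_sample_mean[measurable]: "sample_mean n \<in> borel_measurable (sample_law n \<theta>)"
  unfolding sample_mean_def by (intro borel_measurable_divide borel_measurable_sum) auto

lemma measurable_sample_sd[measurable]: "sample_sd n \<in> borel_measurable (sample_law n \<theta>)"
proof -
  have "(\<lambda>y. (y i - sample_mean n y)\<^sup>2) \<in> borel_measurable (sample_law n \<theta>)" if "i \<in> {1..n}" for i
    using that by measurable
  then have "(\<lambda>y. \<Sum>i=1..n. (y i - sample_mean n y)\<^sup>2) \<in> borel_measurable (sample_law n \<theta>)"
    by (rule borel_measurable_sum)
  then show ?thesis
    unfolding sample_sd_def sample_variance_def by measurable
qed

lemma sample_component_distributed: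
  assumes "i \<in> {1..n}"
  shows "distributed (sample_law n \<theta>) lborel (\<lambda>y. y i) (normal_density \<theta> 1)"
proof -
  have "distr (sample_law n \<theta>) lborel (\<lambda>y. y i)
      = distr (sample_law n \<theta>) (density lborel (\<lambda>x. ennreal (normal_density \<theta> 1 x))) (\<lambda>y. y i)"
    by (intro distr_cong) auto
  also have "\<dots> = density lborel (\<lambda>x. ennreal (normal_density \<theta> 1 x))"
    unfolding sample_law_def using assms
    by (intro distr_PiM_component prob_space_normal_density) auto
  finally show ?thesis
    using measurable_sample_component[OF assms] by (auto simp: distributed_def)
qed

text \<open>Under a product measure the joint law of the coordinates is the product of their laws, and this
  factorization is equivalent to independence.\<close>

lemma indep_sample_components:
  assumes "n \<ge> 1"
  shows "prob_space.indep_vars (sample_law n \<theta>) (\<lambda>_. borel) (\<lambda>i y. y i) {1..n}"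
proof -
  interpret prob_space "sample_law n \<theta>" by (rule prob_space_sample_law)
  let ?N = "density lborel (\<lambda>x. ennreal (normal_density \<theta> 1 x))"
  have "distr (sample_law n \<theta>) (Pi\<^sub>M {1..n} (\<lambda>_. borel)) (\<lambda>y. \<lambda>i\<in>{1..n}. y i)
      = distr (sample_law n \<theta>) (sample_law n \<theta>) (\<lambda>y. y)"
    by (intro distr_cong refl)
       (auto simp: sample_law_def space_PiM PiE_def extensional_def fun_eq_iff intro!: sets_PiM_cong)
  also have "\<dots> = (\<Pi>\<^sub>M i\<in>{1..n}. distr (sample_law n \<theta>) borel (\<lambda>y. y i))"
    unfolding sample_law_def distr_id
  proof (intro PiM_cong refl)
    fix i assume i: "i \<in> {1..n}"
    have "distr (sample_law n \<theta>) borel (\<lambda>y. y i) = distr (sample_law n \<theta>) lborel (\<lambda>y. y i)"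
      by (intro distr_cong) auto
    then show "?N = distr (Pi\<^sub>M {1..n} (\<lambda>_. ?N)) borel (\<lambda>y. y i)"
      using distributed_distr_eq_density[OF sample_component_distributed[OF i]]
      by (simp add: sample_law_def)
  qed
  finally show ?thesis
    using assms by (subst indep_vars_iff_distr_eq_PiM') auto
qed

lemma standardized_mean_distributed:
  assumes "n \<ge> 1"
  shows "distributed (sample_law n \<theta>) lborel
    (\<lambda>y. sqrt n * (sample_mean n y - \<theta>)) std_normal_density"
proof -
  interpret prob_space "sample_law n \<theta>" by (rule prob_space_sample_law)
  have "distributed (sample_law n \<theta>) lborel (\<lambda>y. \<Sum>i\<in>{1..n}. y i)
      (normal_density (\<Sum>i\<in>{1..n}. \<theta>) (sqrt (\<Sum>i\<in>{1..n}. 1\<^sup>2)))"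
    using assms
    by (intro sum_indep_normal indep_sample_components sample_component_distributed) auto
  then have "distributed (sample_law n \<theta>) lborel (\<lambda>y. \<Sum>i\<in>{1..n}. y i) (normal_density (n * \<theta>) (sqrt n))"
    by simp
  then have "distributed (sample_law n \<theta>) lborel (\<lambda>y. ((\<Sum>i\<in>{1..n}. y i) - n * \<theta>) / sqrt n) std_normal_density"
    using assms by (subst normal_standard_normal_convert[symmetric]) auto
  moreover have "((\<Sum>i\<in>{1..n}. y i) - n * \<theta>) / sqrt n = sqrt n * (sample_mean n y - \<theta>)" for y
    using assms by (simp add: sample_mean_def field_simps)
  ultimately show ?thesis by simp
qed

section \<open>Concentration of the sample standard deviation\<close>

text \<open>In the expanded square, independence and centring make every mixed term vanish.\<close>

lemma (in prob_space) second_moment_sum_indep_centered: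
  fixes U :: "'i \<Rightarrow> 'a \<Rightarrow> real"
  assumes fin: "finite I" and indep: "indep_vars (\<lambda>_. borel) U I"
    and int: "\<And>i. i \<in> I \<Longrightarrow> integrable M (U i)"
    and sq: "\<And>i. i \<in> I \<Longrightarrow> integrable M (\<lambda>x. (U i x)\<^sup>2)"
    and zero: "\<And>i. i \<in> I \<Longrightarrow> expectation (U i) = 0"
  shows "integrable M (\<lambda>x. (\<Sum>i\<in>I. U i x)\<^sup>2)"
    and "expectation (\<lambda>x. (\<Sum>i\<in>I. U i x)\<^sup>2) = (\<Sum>i\<in>I. expectation (\<lambda>x. (U i x)\<^sup>2))"
proof -
  have expand: "(\<lambda>x. (\<Sum>i\<in>I. U i x)\<^sup>2) = (\<lambda>x. \<Sum>i\<in>I. \<Sum>j\<in>I. U i x * U j x)"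
    by (simp add: power2_eq_square sum_product)
  have pair: "integrable M (\<lambda>x. U i x * U j x)"
      "expectation (\<lambda>x. U i x * U j x) = (if i = j then expectation (\<lambda>x. (U i x)\<^sup>2) else 0)"
    if ij: "i \<in> I" "j \<in> I" for i j
  proof -
    have "integrable M (\<lambda>x. U i x * U j x) \<and>
      expectation (\<lambda>x. U i x * U j x) = (if i = j then expectation (\<lambda>x. (U i x)\<^sup>2) else 0)"
    proof (cases "i = j")
      case True
      then show ?thesis using sq[OF ij(1)] by (simp add: power2_eq_square)
    next
      case False
      have sub: "indep_vars (\<lambda>_. borel) U {i, j}"
        using indep ij by (rule_tac indep_vars_subset) auto
      have "integrable M (\<lambda>x. \<Prod>k\<in>{i, j}. U k x)"
        using sub int ij by (intro indep_vars_integrable) auto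
      moreover have "expectation (\<lambda>x. \<Prod>k\<in>{i, j}. U k x) = (\<Prod>k\<in>{i, j}. expectation (U k))"
        using sub int ij by (intro indep_vars_lebesgue_integral) auto
      ultimately show ?thesis using False zero ij by simp
    qed
    then show "integrable M (\<lambda>x. U i x * U j x)"
      "expectation (\<lambda>x. U i x * U j x) = (if i = j then expectation (\<lambda>x. (U i x)\<^sup>2) else 0)"
      by auto
  qed
  show "integrable M (\<lambda>x. (\<Sum>i\<in>I. U i x)\<^sup>2)"
    unfolding expand by (intro Bochner_Integration.integrable_sum pair)
  have "expectation (\<lambda>x. (\<Sum>i\<in>I. U i x)\<^sup>2) = (\<Sum>i\<in>I. \<Sum>j\<in>I. expectation (\<lambda>x. U i x * U j x))"
    unfolding expand using pair(1)
    by (subst Bochner_Integration.integral_sum; (intro Bochner_Integration.integrable_sum)?; simp)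
  also have "\<dots> = (\<Sum>i\<in>I. expectation (\<lambda>x. (U i x)\<^sup>2))"
    using fin by (simp add: pair(2) cong: sum.cong)
  finally show "expectation (\<lambda>x. (\<Sum>i\<in>I. U i x)\<^sup>2) = (\<Sum>i\<in>I. expectation (\<lambda>x. (U i x)\<^sup>2))" .
qed

lemma (in prob_space) std_normal_moments:
  assumes X: "distributed M lborel X std_normal_density"
  shows "integrable M (\<lambda>x. X x ^ k)"
    and "expectation (\<lambda>x. X x ^ (2 * k)) = fact (2 * k) / (2 ^ k * fact k)"
proof -
  show "integrable M (\<lambda>x. X x ^ k)"
    using distributed_integrable[OF X, of "\<lambda>x. x ^ k"] integrable_std_normal_moment[of k] by simp
  show "expectation (\<lambda>x. X x ^ (2 * k)) = fact (2 * k) / (2 ^ k * fact k)"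
    using distributed_integral[OF X, of "\<lambda>x. x ^ (2 * k)"] integral_std_normal_moment_even[of k] by simp
qed

text \<open>For a standard normal \<open>Z\<close>, the second and fourth moments \<open>1\<close> and \<open>3\<close> give
  \<open>E (Z\<^sup>2 - 1)\<^sup>2 = 3 - 2 + 1 = 2\<close>.\<close>

lemma sum_centered_squares_second_moment:
  fixes n :: nat and \<theta> :: real
  assumes n: "n \<ge> 1"
  defines "A \<equiv> \<lambda>y :: nat \<Rightarrow> real. \<Sum>i=1..n. ((y i - \<theta>)\<^sup>2 - 1)"
  shows "integrable (sample_law n \<theta>) (\<lambda>y. (A y)\<^sup>2)"
    and "(\<integral>y. (A y)\<^sup>2 \<partial>sample_law n \<theta>) = 2 * n"
proof -
  interpret prob_space "sample_law n \<theta>" by (rule prob_space_sample_law)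
  let ?U = "\<lambda>i (y :: nat \<Rightarrow> real). (y i - \<theta>)\<^sup>2 - 1"
  have Z: "distributed (sample_law n \<theta>) lborel (\<lambda>y. y i - \<theta>) std_normal_density" if "i \<in> {1..n}" for i
    using sample_component_distributed[OF that, of \<theta>] normal_standard_normal_convert[of 1 "\<lambda>y. y i" \<theta>]
    by simp
  have indep: "indep_vars (\<lambda>_. borel) (\<lambda>i y. ?U i y) {1..n}"
    by (rule indep_vars_compose2[OF indep_sample_components[OF n]]) auto
  have sq_expand: "(\<lambda>y. (?U i y)\<^sup>2) = (\<lambda>y. (y i - \<theta>) ^ 4 - 2 * (y i - \<theta>)\<^sup>2 + 1)" for i
    by (simp add: fun_eq_iff power2_eq_square power4_eq_xxxx algebra_simps)
  have mom: "integrable (sample_law n \<theta>) (\<lambda>y. (y i - \<theta>) ^ k)"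
    "expectation (\<lambda>y. (y i - \<theta>)\<^sup>2) = 1" "expectation (\<lambda>y. (y i - \<theta>) ^ 4) = 3"
    if "i \<in> {1..n}" for i k
    using std_normal_moments[OF Z[OF that]] std_normal_moments(2)[OF Z[OF that], of 1]
      std_normal_moments(2)[OF Z[OF that], of 2] by (simp_all add: fact_numeral)
  have U: "integrable (sample_law n \<theta>) (?U i)" "expectation (?U i) = 0"
    "integrable (sample_law n \<theta>) (\<lambda>y. (?U i y)\<^sup>2)" "expectation (\<lambda>y. (?U i y)\<^sup>2) = 2"
    if i: "i \<in> {1..n}" for i
    unfolding sq_expand using mom[OF i] by (auto simp: prob_space)
  show "integrable (sample_law n \<theta>) (\<lambda>y. (A y)\<^sup>2)"
    unfolding A_def by (intro second_moment_sum_indep_centered indep U) auto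
  have "expectation (\<lambda>y. (A y)\<^sup>2) = (\<Sum>i=1..n. expectation (\<lambda>y. (?U i y)\<^sup>2))"
    unfolding A_def by (intro second_moment_sum_indep_centered indep U) auto
  also have "\<dots> = (\<Sum>i=1..n. 2)" by (intro sum.cong U refl)
  finally show "expectation (\<lambda>y. (A y)\<^sup>2) = 2 * n" by simp
qed

text \<open>The classical identity \<open>\<Sum>(y\<^sub>i - m)\<^sup>2 = \<Sum>(y\<^sub>i - \<theta>)\<^sup>2 - n (m - \<theta>)\<^sup>2\<close> for the mean \<open>m\<close> splits the error
  of the sample variance into a sum of independent centred terms of order \<open>\<surd>n\<close> and the square of a
  standard normal variable, of order \<open>1\<close>.\<close>

lemma sample_variance_decomp:
  assumes n: "n \<ge> 2"
  shows "(real n - 1) * (sample_variance n y - 1)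
    = (\<Sum>i=1..n. ((y i - \<theta>)\<^sup>2 - 1)) - (sqrt n * (sample_mean n y - \<theta>))\<^sup>2 + 1"
proof -
  define d where "d = sample_mean n y - \<theta>"
  have d: "(\<Sum>i=1..n. y i - \<theta>) = n * d"
    using n by (simp add: d_def sample_mean_def sum_subtractf field_simps)
  have "(\<Sum>i=1..n. (y i - sample_mean n y)\<^sup>2) = (\<Sum>i=1..n. (y i - \<theta>)\<^sup>2 - 2 * d * (y i - \<theta>) + d\<^sup>2)"
    by (intro sum.cong refl) (simp add: d_def power2_eq_square algebra_simps)
  also have "\<dots> = (\<Sum>i=1..n. (y i - \<theta>)\<^sup>2) - 2 * d * (\<Sum>i=1..n. y i - \<theta>) + n * d\<^sup>2"
    by (simp only: sum.distrib sum_subtractf[of "\<lambda>i. (y i - \<theta>)\<^sup>2"] sum_distrib_left[symmetric]) simp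
  also have "\<dots> = (\<Sum>i=1..n. (y i - \<theta>)\<^sup>2) - n * d\<^sup>2"
    unfolding d by (simp add: power2_eq_square)
  finally have S: "(\<Sum>i=1..n. (y i - sample_mean n y)\<^sup>2) = (\<Sum>i=1..n. (y i - \<theta>)\<^sup>2) - n * d\<^sup>2" .
  have "(real n - 1) * (sample_variance n y - 1) = (\<Sum>i=1..n. (y i - sample_mean n y)\<^sup>2) - (real n - 1)"
    using n by (simp add: sample_variance_def right_diff_distrib)
  then show ?thesis
    unfolding S d_def[symmetric] by (simp add: sum_subtractf power_mult_distrib)
qed

text \<open>The first part of the error exceeds \<open>L \<surd>n\<close> with probability at most \<open>2 / L\<^sup>2\<close>, by Chebyshev's
  inequality; the second part has mean \<open>1\<close> and exceeds \<open>L \<surd>n\<close> with probability at most \<open>1 / (L \<surd>n)\<close>,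
  by Markov's inequality.  The estimate passes from the variance to the standard deviation because
  \<open>\<bar>s - 1\<bar> \<le> \<bar>s - 1\<bar> (s + 1) = \<bar>s\<^sup>2 - 1\<bar>\<close> for \<open>s \<ge> 0\<close>.\<close>

lemma sample_sd_tight:
  assumes n: "n \<ge> 2" and L: "L \<ge> 1"
  shows "\<P>(y in sample_law n \<theta>. \<bar>sample_sd n y - 1\<bar> > 6 * L / sqrt n) \<le> 3 / L"
proof -
  interpret prob_space "sample_law n \<theta>" by (rule prob_space_sample_law)
  define A where "A = (\<lambda>y :: nat \<Rightarrow> real. \<Sum>i=1..n. ((y i - \<theta>)\<^sup>2 - 1))"
  define W where "W = (\<lambda>y. sqrt n * (sample_mean n y - \<theta>))"
  have [measurable]: "W \<in> borel_measurable (sample_law n \<theta>)" unfolding W_def by measurable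
  have [measurable]: "A \<in> borel_measurable (sample_law n \<theta>)"
    unfolding A_def by (intro borel_measurable_sum) measurable
  have n1: "n \<ge> 1" using n by simp
  have Ls: "L * sqrt n > 0" "sqrt n \<ge> 1" using n L by auto
  have A2: "integrable (sample_law n \<theta>) (\<lambda>y. (A y)\<^sup>2)" "expectation (\<lambda>y. (A y)\<^sup>2) = 2 * n"
    unfolding A_def by (rule sum_centered_squares_second_moment[OF n1])+
  note Wd = standardized_mean_distributed[OF n1, of \<theta>, folded W_def]
  have W2: "integrable (sample_law n \<theta>) (\<lambda>y. (W y)\<^sup>2)" "expectation (\<lambda>y. (W y)\<^sup>2) = 1"
    using std_normal_moments(1)[OF Wd, of 2] std_normal_moments(2)[OF Wd, of 1] by simp_all
  have PA: "\<P>(y in sample_law n \<theta>. (A y)\<^sup>2 \<ge> (L * sqrt n)\<^sup>2) \<le> 2 / L"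
  proof -
    have "\<P>(y in sample_law n \<theta>. (A y)\<^sup>2 \<ge> (L * sqrt n)\<^sup>2) \<le> 2 * n / (L * sqrt n)\<^sup>2"
      using integral_Markov_inequality_measure[OF A2(1), of "{}" "(L * sqrt n)\<^sup>2"] A2(2) Ls L n by simp
    also have "\<dots> = 2 / L * (1 / L)"
    proof -
      have "(L * sqrt n)\<^sup>2 = L * L * n" by (simp add: power_mult_distrib power2_eq_square[of L])
      then show ?thesis using L n by simp
    qed
    also have "\<dots> \<le> 2 / L * 1" using L by (intro mult_left_mono) auto
    finally show ?thesis by simp
  qed
  have PW: "\<P>(y in sample_law n \<theta>. (W y)\<^sup>2 \<ge> L * sqrt n) \<le> 1 / L"
  proof -
    have "\<P>(y in sample_law n \<theta>. (W y)\<^sup>2 \<ge> L * sqrt n) \<le> 1 / (L * sqrt n)"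
      using integral_Markov_inequality_measure[OF W2(1), of "{}" "L * sqrt n"] W2(2) Ls by simp
    also have "\<dots> \<le> 1 / L" using Ls L by (intro divide_left_mono) auto
    finally show ?thesis .
  qed
  have dev: "\<bar>sample_sd n y - 1\<bar> \<le> 6 * L / sqrt n"
    if "(A y)\<^sup>2 < (L * sqrt n)\<^sup>2" "(W y)\<^sup>2 < L * sqrt n" for y
  proof -
    have A: "\<bar>A y\<bar> < L * sqrt n" using that(1) Ls power2_less_imp_less[of "\<bar>A y\<bar>" "L * sqrt n"] by simp
    have v0: "sample_variance n y \<ge> 0"
      unfolding sample_variance_def using n by (intro divide_nonneg_nonneg sum_nonneg) auto
    have decomp: "(real n - 1) * (sample_variance n y - 1) = A y - (W y)\<^sup>2 + 1"
      unfolding A_def W_def by (rule sample_variance_decomp[OF n])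
    \<comment> \<open>The constant term of the decomposition is absorbed by a third copy of \<open>L \<surd>n\<close>.\<close>
    have "1 * 1 \<le> L * sqrt n" using L Ls by (intro mult_mono) auto
    then have "\<bar>(real n - 1) * (sample_variance n y - 1)\<bar> \<le> 3 * L * sqrt n"
      unfolding decomp
      using A that(2) zero_le_power2[of "W y"] by linarith
    then have "(real n - 1) * \<bar>sample_variance n y - 1\<bar> \<le> 3 * L * sqrt n"
      using n by (simp add: abs_mult)
    \<comment> \<open>For \<open>n \<ge> 2\<close>, dividing by \<open>n - 1\<close> costs at most a factor \<open>2\<close> against dividing by \<open>n\<close>.\<close>
    moreover have "n / 2 * \<bar>sample_variance n y - 1\<bar> \<le> (real n - 1) * \<bar>sample_variance n y - 1\<bar>"
      using n by (intro mult_right_mono) auto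
    ultimately have "sqrt n * sqrt n * \<bar>sample_variance n y - 1\<bar> \<le> 6 * L * sqrt n"
      by simp
    then have "sqrt n * \<bar>sample_variance n y - 1\<bar> \<le> 6 * L"
      using Ls mult_le_cancel_left_pos[of "sqrt n" "sqrt n * \<bar>sample_variance n y - 1\<bar>" "6 * L"]
      by (simp only: mult_ac)
    then have "\<bar>sample_variance n y - 1\<bar> \<le> 6 * L / sqrt n"
      using Ls n by (simp add: field_simps)
    moreover have "\<bar>sample_sd n y - 1\<bar> * 1 \<le> \<bar>sample_sd n y - 1\<bar> * \<bar>sample_sd n y + 1\<bar>"
      using v0 by (intro mult_left_mono) (auto simp: sample_sd_def)
    then have "\<bar>sample_sd n y - 1\<bar> \<le> \<bar>(sample_sd n y)\<^sup>2 - 1\<bar>"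
      unfolding abs_mult[symmetric] by (simp add: power2_eq_square algebra_simps)
    then have "\<bar>sample_sd n y - 1\<bar> \<le> \<bar>sample_variance n y - 1\<bar>"
      using v0 by (simp add: sample_sd_def)
    ultimately show ?thesis by simp
  qed
  have "\<P>(y in sample_law n \<theta>. \<bar>sample_sd n y - 1\<bar> > 6 * L / sqrt n)
     \<le> prob ({y \<in> space (sample_law n \<theta>). (A y)\<^sup>2 \<ge> (L * sqrt n)\<^sup>2}
          \<union> {y \<in> space (sample_law n \<theta>). (W y)\<^sup>2 \<ge> L * sqrt n})"
  proof (intro finite_measure_mono subsetI)
    fix y assume "y \<in> {y \<in> space (sample_law n \<theta>). \<bar>sample_sd n y - 1\<bar> > 6 * L / sqrt n}"
    then have "(A y)\<^sup>2 \<ge> (L * sqrt n)\<^sup>2 \<or> (W y)\<^sup>2 \<ge> L * sqrt n" and "y \<in> space (sample_law n \<theta>)"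
      using dev[of y] by force+
    then show "y \<in> {y \<in> space (sample_law n \<theta>). (A y)\<^sup>2 \<ge> (L * sqrt n)\<^sup>2}
          \<union> {y \<in> space (sample_law n \<theta>). (W y)\<^sup>2 \<ge> L * sqrt n}"
      by blast
  qed measurable
  also have "\<dots> \<le> 2 / L + 1 / L"
    using PA PW by (intro order_trans[OF measure_Un_le] add_mono) auto
  finally show ?thesis by simp
qed

section \<open>Thresholded intervals with a general scale\<close>

definition thresholded_interval ::
    "(real \<Rightarrow> real \<Rightarrow> real set) \<Rightarrow> real \<Rightarrow> real \<Rightarrow> real \<Rightarrow> real \<Rightarrow> real set" where
  "thresholded_interval ivl \<eta> a s m =
     (let t = if \<bar>m\<bar> > s * \<eta> then m else 0 in ivl (t - s * a) (t + s * a))"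

abbreviation (input) interval_kinds :: "(real \<Rightarrow> real \<Rightarrow> real set) set" where
  "interval_kinds \<equiv> {atLeastAtMost, greaterThanLessThan, greaterThanAtMost, atLeastLessThan}"

lemma interval_feasible_eq:
  "interval_feasible ivl n \<eta> a y = thresholded_interval ivl \<eta> a (sample_sd n y) (sample_mean n y)"
  by (simp add: interval_feasible_def thresholded_interval_def hard_threshold_feasible_def Let_def)

lemma interval_known_eq:
  "interval_known ivl n \<eta> a y = thresholded_interval ivl \<eta> a 1 (sample_mean n y)"
  by (simp add: interval_known_def thresholded_interval_def hard_threshold_known_def Let_def)

text \<open>This is the worst-case condition for coverage, valid for all parameters of one sign at once; \<open>d\<close> is
  the error of the mean \<open>m\<close>, reflected when \<open>\<theta>\<close> is negative.  The bounds on \<open>d\<close> put \<open>m\<close> within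
  \<open>(1 - \<kappa>) a\<close>, the smallest possible half-length, of \<open>\<theta>\<close>, which settles the case that \<open>m\<close> survives the thresholding.  If \<open>m\<close> is replaced by
  \<open>0\<close>, then \<open>\<bar>m\<bar> \<le> (1 + \<kappa>) \<eta>\<close>, and the lower bound on \<open>d\<close> forces \<open>\<bar>\<theta>\<bar>\<close> itself to be smaller than that
  half-length, so that \<open>0\<close> is close enough.\<close>

lemma mem_thresholded_intervalI:
  assumes ivl: "ivl \<in> interval_kinds" and nonneg: "0 \<le> \<eta>" "0 \<le> a"
    and s: "\<bar>s - 1\<bar> \<le> \<kappa>"
    and d: "d = m - \<theta> \<and> 0 \<le> \<theta> \<or> d = \<theta> - m \<and> \<theta> \<le> 0"
    and lo: "(1 + \<kappa>) * \<eta> - (1 - \<kappa>) * a < d" and hi: "d < (1 - \<kappa>) * a"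
  shows "\<theta> \<in> thresholded_interval ivl \<eta> a s m"
proof -
  have sub: "{l<..<u} \<subseteq> ivl l u" for l u using ivl by auto
  have sa: "(1 - \<kappa>) * a \<le> s * a" and s\<eta>: "s * \<eta> \<le> (1 + \<kappa>) * \<eta>"
    using s nonneg by (auto intro!: mult_right_mono)
  have "0 \<le> (1 + \<kappa>) * \<eta>" using s nonneg by (intro mult_nonneg_nonneg) auto
  then have m: "\<bar>m - \<theta>\<bar> < (1 - \<kappa>) * a" using lo hi d by auto
  define t where "t = (if \<bar>m\<bar> > s * \<eta> then m else 0)"
  have eq: "thresholded_interval ivl \<eta> a s m = ivl (t - s * a) (t + s * a)"
    by (simp add: thresholded_interval_def t_def Let_def)
  have "\<bar>t - \<theta>\<bar> < s * a"
  proof (cases "\<bar>m\<bar> > s * \<eta>")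
    case True
    then show ?thesis using m sa by (simp add: t_def)
  next
    case False
    then have "\<bar>\<theta>\<bar> < (1 - \<kappa>) * a" using lo d s\<eta> by auto
    then show ?thesis using False sa by (simp add: t_def)
  qed
  then have "\<theta> \<in> {t - s * a<..<t + s * a}" by auto
  then show ?thesis unfolding eq using sub by blast
qed

text \<open>When \<open>\<theta>\<close> exceeds every possible half-length, an interval around \<open>0\<close> cannot contain it.  Coverage then
  forces \<open>m\<close> to be positive and to survive the thresholding.\<close>

lemma mem_thresholded_intervalD:
  assumes ivl: "ivl \<in> interval_kinds" and nonneg: "0 \<le> \<eta>" "0 \<le> a"
    and s: "\<bar>s - 1\<bar> \<le> \<kappa>" and \<theta>: "\<theta> > (1 + \<kappa>) * a"
    and mem: "\<theta> \<in> thresholded_interval ivl \<eta> a s m"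
  shows "(1 - \<kappa>) * \<eta> - \<theta> \<le> m - \<theta>" and "m - \<theta> \<le> (1 + \<kappa>) * a"
proof -
  have sub: "ivl l u \<subseteq> {l..u}" for l u using ivl by auto
  have sa: "s * a \<le> (1 + \<kappa>) * a" and s\<eta>: "(1 - \<kappa>) * \<eta> \<le> s * \<eta>"
    using s nonneg by (auto intro!: mult_right_mono)
  define t where "t = (if \<bar>m\<bar> > s * \<eta> then m else 0)"
  have eq: "thresholded_interval ivl \<eta> a s m = ivl (t - s * a) (t + s * a)"
    by (simp add: thresholded_interval_def t_def Let_def)
  have "\<theta> \<in> {t - s * a..t + s * a}"
    using mem sub unfolding eq by blast
  then have t: "\<bar>t - \<theta>\<bar> \<le> s * a" by auto
  then have "t > 0" using \<theta> sa by auto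
  then have tm: "t = m" "\<bar>m\<bar> > s * \<eta>" by (auto simp: t_def split: if_splits)
  show "(1 - \<kappa>) * \<eta> - \<theta> \<le> m - \<theta>" using tm \<open>t > 0\<close> s\<eta> by auto
  show "m - \<theta> \<le> (1 + \<kappa>) * a" using t tm sa by auto
qed

lemma sets_coverage_event:
  assumes ivl: "ivl \<in> interval_kinds"
    and [measurable]: "s \<in> borel_measurable M" "m \<in> borel_measurable M"
  shows "{y \<in> space M. \<theta> \<in> thresholded_interval ivl \<eta> a (s y) (m y)} \<in> sets M"
  using ivl by (elim insertE emptyE; simp add: thresholded_interval_def Let_def)

section \<open>Infimal coverage probability\<close>

text \<open>By symmetry of the normal law, the reflected error has the same law as the error itself, so that the
  same bound holds for every \<open>\<theta>\<close>.\<close>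

lemma coverage_lower:
  assumes n: "n \<ge> 1" and ivl: "ivl \<in> interval_kinds" and nonneg: "0 \<le> \<eta>" "0 \<le> a"
    and [measurable]: "s \<in> borel_measurable (sample_law n \<theta>)"
    and tight: "\<P>(y in sample_law n \<theta>. \<bar>s y - 1\<bar> > K / sqrt n) \<le> \<epsilon>"
  shows "Phi (sqrt n * a - K * a) - Phi (sqrt n * (\<eta> - a) + K * (\<eta> + a)) - \<epsilon>
    \<le> \<P>(y in sample_law n \<theta>. \<theta> \<in> thresholded_interval ivl \<eta> a (s y) (sample_mean n y))"
proof -
  interpret prob_space "sample_law n \<theta>" by (rule prob_space_sample_law)
  let ?M = "sample_law n \<theta>"
  define cov where "cov = {y \<in> space ?M. \<theta> \<in> thresholded_interval ivl \<eta> a (s y) (sample_mean n y)}"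
  define bad where "bad = {y \<in> space ?M. \<bar>s y - 1\<bar> > K / sqrt n}"
  define W where "W = (\<lambda>y. sqrt n * (sample_mean n y - \<theta>))"
  define X where "X = (if 0 \<le> \<theta> then W else (\<lambda>y. - W y))"
  define l where "l = sqrt n * (\<eta> - a) + K * (\<eta> + a)"
  define u where "u = sqrt n * a - K * a"
  define E where "E = {y \<in> space ?M. X y \<in> {l<..<u}}"
  have n0: "sqrt n > 0" using n by simp
  have [measurable]: "W \<in> borel_measurable ?M" unfolding W_def by measurable
  have [measurable]: "X \<in> borel_measurable ?M" unfolding X_def by simp
  have Wd: "distributed ?M lborel W std_normal_density"
    unfolding W_def by (rule standardized_mean_distributed[OF n])
  then have Xd: "distributed ?M lborel X std_normal_density"
    using normal_density_affine[OF Wd, of "-1" 0] by (simp add: X_def)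
  have meas: "cov \<in> sets ?M" "bad \<in> sets ?M" "E \<in> sets ?M"
    unfolding cov_def bad_def E_def by (rule sets_coverage_event[OF ivl]; measurable) measurable
  have sub: "E \<subseteq> cov \<union> bad"
  proof
    fix y assume y: "y \<in> E"
    define \<kappa> where "\<kappa> = K / sqrt n"
    define d where "d = X y / sqrt n"
    have K: "K = \<kappa> * sqrt n" using n0 by (simp add: \<kappa>_def)
    have X: "X y = sqrt n * d" using n0 by (simp add: d_def)
    have "sqrt n * ((1 + \<kappa>) * \<eta> - (1 - \<kappa>) * a) < sqrt n * d" "sqrt n * d < sqrt n * ((1 - \<kappa>) * a)"
      using y unfolding E_def X[symmetric] l_def u_def K by (auto simp: algebra_simps)
    then have lo: "(1 + \<kappa>) * \<eta> - (1 - \<kappa>) * a < d" and hi: "d < (1 - \<kappa>) * a"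
      using n0 by simp_all
    have d: "d = sample_mean n y - \<theta> \<and> 0 \<le> \<theta> \<or> d = \<theta> - sample_mean n y \<and> \<theta> \<le> 0"
      using n0 by (auto simp: d_def X_def W_def field_simps)
    show "y \<in> cov \<union> bad"
    proof (cases "\<bar>s y - 1\<bar> \<le> \<kappa>")
      case True
      then show ?thesis
        using mem_thresholded_intervalI[OF ivl nonneg True d lo hi] y by (auto simp: cov_def E_def)
    next
      case False
      then show ?thesis using y by (auto simp: bad_def E_def \<kappa>_def)
    qed
  qed
  have "Phi u - Phi l \<le> prob E"
  proof (cases "l \<le> u")
    case True
    then show ?thesis
      using distributed_std_normal_prob[OF Xd, of "{l<..<u}"] measure_std_normal_interval(2)[of l u]
      by (simp add: E_def)
  next
    case False
    then have "Phi u - Phi l \<le> 0" using Phi_mono[of u l] by simp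
    then show ?thesis using measure_nonneg[of ?M E] by linarith
  qed
  also have "\<dots> \<le> prob (cov \<union> bad)" using sub meas by (intro finite_measure_mono) auto
  also have "\<dots> \<le> prob cov + prob bad" using meas by (intro measure_Un_le)
  also have "prob bad \<le> \<epsilon>" using tight by (simp add: bad_def)
  finally show ?thesis by (simp add: cov_def u_def l_def)
qed

text \<open>The parameter is the least favourable one up to a margin: it exceeds the largest half-length
  \<open>(1 + K / \<surd>n) a\<close> by \<open>1 / n\<close>.  The margin is needed for strictness, as when \<open>a = 0\<close>, and it is small
  enough to cost only \<open>1 / \<surd>n\<close> on the scale of the standardized mean.\<close>

lemma coverage_upper:
  assumes n: "n \<ge> 1" and ivl: "ivl \<in> interval_kinds" and nonneg: "0 \<le> \<eta>" "0 \<le> a"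
    and \<theta>: "\<theta> = (1 + K / sqrt n) * a + 1 / n"
    and [measurable]: "s \<in> borel_measurable (sample_law n \<theta>)"
    and tight: "\<P>(y in sample_law n \<theta>. \<bar>s y - 1\<bar> > K / sqrt n) \<le> \<epsilon>"
  shows "\<P>(y in sample_law n \<theta>. \<theta> \<in> thresholded_interval ivl \<eta> a (s y) (sample_mean n y))
    \<le> max 0 (Phi (sqrt n * a + K * a) - Phi (sqrt n * (\<eta> - a) - K * (\<eta> + a) - 1 / sqrt n)) + \<epsilon>"
proof -
  interpret prob_space "sample_law n \<theta>" by (rule prob_space_sample_law)
  let ?M = "sample_law n \<theta>"
  define cov where "cov = {y \<in> space ?M. \<theta> \<in> thresholded_interval ivl \<eta> a (s y) (sample_mean n y)}"
  define bad where "bad = {y \<in> space ?M. \<bar>s y - 1\<bar> > K / sqrt n}"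
  define W where "W = (\<lambda>y. sqrt n * (sample_mean n y - \<theta>))"
  define l where "l = sqrt n * (\<eta> - a) - K * (\<eta> + a) - 1 / sqrt n"
  define u where "u = sqrt n * a + K * a"
  define E where "E = {y \<in> space ?M. W y \<in> {l..u}}"
  have n0: "sqrt n > 0" using n by simp
  have [measurable]: "W \<in> borel_measurable ?M" unfolding W_def by measurable
  have Wd: "distributed ?M lborel W std_normal_density"
    unfolding W_def by (rule standardized_mean_distributed[OF n])
  have meas: "cov \<in> sets ?M" "bad \<in> sets ?M" "E \<in> sets ?M"
    unfolding cov_def bad_def E_def by (rule sets_coverage_event[OF ivl]; measurable) measurable
  have sub: "cov \<subseteq> E \<union> bad"
  proof
    fix y assume y: "y \<in> cov"
    define \<kappa> where "\<kappa> = K / sqrt n"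
    have K: "K = \<kappa> * sqrt n" using n0 by (simp add: \<kappa>_def)
    have \<theta>': "\<theta> = (1 + \<kappa>) * a + 1 / n" by (simp add: \<theta> \<kappa>_def)
    have gt: "\<theta> > (1 + \<kappa>) * a" using n by (simp add: \<theta>')
    show "y \<in> E \<union> bad"
    proof (cases "\<bar>s y - 1\<bar> \<le> \<kappa>")
      case True
      have mem: "\<theta> \<in> thresholded_interval ivl \<eta> a (s y) (sample_mean n y)" using y by (simp add: cov_def)
      note D = mem_thresholded_intervalD[OF ivl nonneg True gt mem]
      have "l = sqrt n * ((1 - \<kappa>) * \<eta> - \<theta>)"
        using n by (simp add: l_def K \<theta>' algebra_simps real_div_sqrt divide_simps)
      also have "\<dots> \<le> W y" unfolding W_def using D(1) n0 by (intro mult_left_mono) auto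
      finally have "l \<le> W y" .
      moreover have "W y \<le> sqrt n * ((1 + \<kappa>) * a)"
        unfolding W_def using D(2) n0 by (intro mult_left_mono) auto
      then have "W y \<le> u" by (simp add: u_def K algebra_simps)
      ultimately show ?thesis using y by (auto simp: E_def cov_def)
    next
      case False
      then show ?thesis using y by (auto simp: bad_def cov_def \<kappa>_def)
    qed
  qed
  have "prob cov \<le> prob (E \<union> bad)" using sub meas by (intro finite_measure_mono) auto
  also have "\<dots> \<le> prob E + prob bad" using meas by (intro measure_Un_le)
  also have "prob bad \<le> \<epsilon>" using tight by (simp add: bad_def)
  also have "prob E \<le> max 0 (Phi u - Phi l)"
    using distributed_std_normal_prob[OF Wd, of "{l..u}"] measure_std_normal_interval(1)[of l u]
    by (cases "l \<le> u") (auto simp: E_def)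
  finally show ?thesis by (simp add: cov_def u_def l_def)
qed

text \<open>The infimal coverage with known variance, obtained as the coverage at \<open>\<theta>\<close> decreasing to \<open>a\<close>;
  it vanishes when the threshold \<open>\<eta>\<close> is at least \<open>2 a\<close>.\<close>

definition asymptotic_inf_coverage :: "nat \<Rightarrow> real \<Rightarrow> real \<Rightarrow> real" where
  "asymptotic_inf_coverage n \<eta> a = max 0 (Phi (sqrt n * a) - Phi (sqrt n * (\<eta> - a)))"

lemma inf_coverage_bounds:
  assumes n: "n \<ge> 1" and ivl: "ivl \<in> interval_kinds" and nonneg: "0 \<le> \<eta>" "0 \<le> a"
    and s: "\<And>\<theta>. s \<in> borel_measurable (sample_law n \<theta>)"
    and tight: "\<And>\<theta>. \<P>(y in sample_law n \<theta>. \<bar>s y - 1\<bar> > K / sqrt n) \<le> \<epsilon>"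
  defines "I \<equiv> inf_coverage n (\<lambda>y. thresholded_interval ivl \<eta> a (s y) (sample_mean n y))"
  shows "0 \<le> I" "I \<le> 1"
    and "Phi (sqrt n * a - K * a) - Phi (sqrt n * (\<eta> - a) + K * (\<eta> + a)) - \<epsilon> \<le> I"
    and "I \<le> max 0 (Phi (sqrt n * a + K * a) - Phi (sqrt n * (\<eta> - a) - K * (\<eta> + a) - 1 / sqrt n)) + \<epsilon>"
proof -
  define c where "c = (\<lambda>\<theta>. \<P>(y in sample_law n \<theta>. \<theta> \<in> thresholded_interval ivl \<eta> a (s y) (sample_mean n y)))"
  have I: "I = (INF \<theta>. c \<theta>)" by (simp add: I_def inf_coverage_def c_def)
  have c0: "0 \<le> c \<theta>" and c1: "c \<theta> \<le> 1" for \<theta>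
    using prob_space.prob_le_1[OF prob_space_sample_law] by (auto simp: c_def)
  have Ic: "I \<le> c \<theta>" for \<theta>
    unfolding I using c0 by (intro cINF_lower bdd_belowI[of _ 0]) auto
  show "0 \<le> I" unfolding I using c0 by (intro cINF_greatest) auto
  show "I \<le> 1" using Ic[of 0] c1[of 0] by simp
  show "Phi (sqrt n * a - K * a) - Phi (sqrt n * (\<eta> - a) + K * (\<eta> + a)) - \<epsilon> \<le> I"
    unfolding I c_def by (intro cINF_greatest coverage_lower n ivl nonneg s tight) simp
  show "I \<le> max 0 (Phi (sqrt n * a + K * a) - Phi (sqrt n * (\<eta> - a) - K * (\<eta> + a) - 1 / sqrt n)) + \<epsilon>"
    by (rule order_trans[OF Ic[of "(1 + K / sqrt n) * a + 1 / n"]], unfold c_def,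
        rule coverage_upper[OF n ivl nonneg refl s tight])
qed

text \<open>The approximating sequence is common to all scales \<open>s\<close>, so that any two scales that are close to \<open>1\<close>
  in this sense have asymptotically equal infimal coverage.  The closeness at rate \<open>1 / \<surd>n\<close>
  is what makes the shift \<open>K (\<eta> + a)\<close> of the standardized bounds free of \<open>n\<close>.\<close>

lemma inf_coverage_asymptotics:
  fixes \<eta> a :: "nat \<Rightarrow> real" and s :: "nat \<Rightarrow> (nat \<Rightarrow> real) \<Rightarrow> real"
  assumes \<eta>: "\<And>n. n \<ge> 2 \<Longrightarrow> \<eta> n > 0" "\<eta> \<longlonglongrightarrow> 0" and a: "\<And>n. n \<ge> 2 \<Longrightarrow> a n \<ge> 0"
    and ivl: "ivl \<in> interval_kinds"
    and s: "\<And>n \<theta>. s n \<in> borel_measurable (sample_law n \<theta>)"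
    and tight: "\<And>\<epsilon>. \<epsilon> > 0 \<Longrightarrow> \<exists>K\<ge>0. \<forall>n\<ge>2. \<forall>\<theta>.
      \<P>(y in sample_law n \<theta>. \<bar>s n y - 1\<bar> > K / sqrt n) \<le> \<epsilon>"
  shows "(\<lambda>n. inf_coverage n (\<lambda>y. thresholded_interval ivl (\<eta> n) (a n) (s n y) (sample_mean n y))
    - asymptotic_inf_coverage n (\<eta> n) (a n)) \<longlonglongrightarrow> 0"
proof (rule LIMSEQ_I)
  fix r :: real assume "r > 0"
  define \<epsilon> where "\<epsilon> = r / 6"
  have \<epsilon>: "\<epsilon> > 0" using \<open>r > 0\<close> by (simp add: \<epsilon>_def)
  obtain K where K: "K \<ge> 0" and
    PK: "\<And>n \<theta>. n \<ge> 2 \<Longrightarrow> \<P>(y in sample_law n \<theta>. \<bar>s n y - 1\<bar> > K / sqrt n) \<le> \<epsilon>"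
    using tight[OF \<epsilon>] by blast
  obtain T where T: "Phi (-T) \<le> \<epsilon>" "Phi T \<ge> 1 - \<epsilon>" using Phi_tails[OF \<epsilon>] by blast
  \<comment> \<open>A half-length \<open>a \<le> \<delta>\<close> contributes at most \<open>K a \<le> \<epsilon>\<close> to the shift \<open>K (\<eta> + a)\<close>.\<close>
  define \<delta> where "\<delta> = \<epsilon> / (K + 1)"
  have \<delta>: "\<delta> > 0" "K * \<delta> \<le> \<epsilon>" using K \<epsilon> by (auto simp: \<delta>_def field_simps)
  have sqrt_top: "filterlim (\<lambda>n. sqrt (real n)) at_top sequentially"
    by (intro filterlim_compose[OF sqrt_at_top] filterlim_real_sequentially)
  have "\<forall>\<^sub>F n in sequentially. \<eta> n < \<delta> / 2" using \<eta>(2) \<delta> by (intro order_tendstoD) auto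
  \<comment> \<open>The second bound pushes both arguments of \<open>\<Phi>\<close> beyond \<open>T\<close> and \<open>-T\<close> when \<open>a > \<delta>\<close> and
    \<open>\<eta> < \<delta> / 2\<close>.\<close>
  moreover have "\<forall>\<^sub>F n in sequentially. sqrt n \<ge> max (1 / \<epsilon>) (2 * (\<bar>T\<bar> + 2 * K * \<delta>) / \<delta> + K)"
    using sqrt_top by (simp only: filterlim_at_top)
  moreover have "\<forall>\<^sub>F n in sequentially. n \<ge> (2 :: nat)" by (rule eventually_ge_at_top)
  ultimately have "\<forall>\<^sub>F n in sequentially.
    \<bar>inf_coverage n (\<lambda>y. thresholded_interval ivl (\<eta> n) (a n) (s n y) (sample_mean n y))
      - asymptotic_inf_coverage n (\<eta> n) (a n)\<bar> < r"
  proof eventually_elim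
    case (elim n)
    define x e where "x = a n" and "e = \<eta> n"
    define I where "I = inf_coverage n (\<lambda>y. thresholded_interval ivl e x (s n y) (sample_mean n y))"
    define G where "G = asymptotic_inf_coverage n e x"
    have n: "n \<ge> 2" "n \<ge> 1" using elim by auto
    have x0: "x \<ge> 0" and e0: "e \<ge> 0" and e: "e \<le> \<delta> / 2"
      using \<eta>(1)[OF n(1)] a[OF n(1)] elim by (auto simp: x_def e_def)
    have n_inv0: "0 \<le> 1 / sqrt n" by simp
    have n_inv: "1 / sqrt n \<le> \<epsilon>" and big: "2 * (\<bar>T\<bar> + 2 * K * \<delta>) / \<delta> + K \<le> sqrt n"
      using elim \<epsilon> by (auto simp: field_simps)
    note bounds = inf_coverage_bounds[OF n(2) ivl e0 x0 s PK[OF n(1)], folded I_def]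
    have Ke: "K * e \<le> \<epsilon>" using mult_left_mono[OF e K] \<delta> K \<epsilon> by (auto simp: field_simps)
    have Gdef: "G = max 0 (Phi (sqrt n * x) - Phi (sqrt n * (e - x)))"
      by (simp add: G_def asymptotic_inf_coverage_def)
    have "\<bar>I - G\<bar> < r"
    \<comment> \<open>For small \<open>a\<close> the continuity of \<open>\<Phi>\<close> decides; for \<open>a > \<delta>\<close> both \<open>I\<close> and \<open>G\<close> are close to \<open>1\<close>.\<close>
    proof (cases "x \<le> \<delta>")
      case True
      have Kx: "0 \<le> K * x" "K * x \<le> \<epsilon>" using mult_left_mono[OF True K] \<delta> K x0 by auto
      have Kex: "0 \<le> K * (e + x)" "K * (e + x) \<le> 2 * \<epsilon>"
        using Ke Kx K e0 x0 by (auto simp: distrib_left)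
      have "Phi (sqrt n * x) - Phi (sqrt n * x - K * x) \<le> \<epsilon>"
        using Phi_diff_le[of "sqrt n * x - K * x" "sqrt n * x"] Kx by simp
      moreover have "Phi (sqrt n * (e - x) + K * (e + x)) - Phi (sqrt n * (e - x)) \<le> 2 * \<epsilon>"
        using Phi_diff_le[of "sqrt n * (e - x)" "sqrt n * (e - x) + K * (e + x)"] Kex by simp
      ultimately have "G - 4 * \<epsilon> \<le> I" using bounds(1,3) \<epsilon> unfolding Gdef by linarith
      moreover have "Phi (sqrt n * x + K * x) - Phi (sqrt n * x) \<le> \<epsilon>"
        using Phi_diff_le[of "sqrt n * x" "sqrt n * x + K * x"] Kx by simp
      moreover have "Phi (sqrt n * (e - x)) - Phi (sqrt n * (e - x) - K * (e + x) - 1 / sqrt n) \<le> 3 * \<epsilon>"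
        using Phi_diff_le[of "sqrt n * (e - x) - K * (e + x) - 1 / sqrt n" "sqrt n * (e - x)"] Kex n_inv
          n_inv0 by linarith
      ultimately have "\<bar>I - G\<bar> \<le> 5 * \<epsilon>" using bounds(4) \<epsilon> unfolding Gdef by linarith
      then show ?thesis using \<open>r > 0\<close> by (simp add: \<epsilon>_def)
    next
      case False
      have "(2 * (\<bar>T\<bar> + 2 * K * \<delta>) / \<delta>) * (\<delta> / 2) \<le> (sqrt n - K) * (\<delta> / 2)"
        using big \<delta> by (intro mult_right_mono) auto
      then have T': "\<bar>T\<bar> + 2 * K * \<delta> \<le> (sqrt n - K) * (\<delta> / 2)" using \<delta> by simp
      have nK: "sqrt n - K \<ge> 0" using big \<delta> K
        by (smt (verit) divide_nonneg_pos mult_nonneg_nonneg)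
      have h1: "(sqrt n - K) * \<delta> \<le> (sqrt n - K) * x" using nK False by (intro mult_left_mono) auto
      have h2: "(sqrt n + K) * e \<le> (sqrt n + K) * (\<delta> / 2)" using e K by (intro mult_left_mono) auto
      have p: "0 \<le> K * \<delta>" "0 \<le> (sqrt n - K) * \<delta>" "0 \<le> K * x" "0 \<le> K * (e + x)"
        using K \<delta> nK x0 e0 by auto
      have hi: "T \<le> sqrt n * x - K * x"
        using h1 T' p abs_ge_self[of T] by (simp add: algebra_simps)
      have lo: "sqrt n * (e - x) + K * (e + x) \<le> - T"
        using h1 h2 T' p abs_ge_self[of T] by (simp add: algebra_simps)
      have "1 - \<epsilon> \<le> Phi (sqrt n * x - K * x)" using Phi_mono[OF hi] T by simp
      moreover have "Phi (sqrt n * x - K * x) \<le> Phi (sqrt n * x)" using p by (intro Phi_mono) auto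
      moreover have "Phi (sqrt n * (e - x) + K * (e + x)) \<le> \<epsilon>" using Phi_mono[OF lo] T by simp
      moreover have "Phi (sqrt n * (e - x)) \<le> Phi (sqrt n * (e - x) + K * (e + x))"
        using p by (intro Phi_mono) auto
      ultimately have "1 - 3 * \<epsilon> \<le> I" "1 - 2 * \<epsilon> \<le> G" using bounds(3) unfolding Gdef by linarith+
      moreover have "G \<le> 1" unfolding Gdef
        using Phi_bounds(2)[of "sqrt n * x"] Phi_bounds(1)[of "sqrt n * (e - x)"] by linarith
      ultimately have "\<bar>I - G\<bar> \<le> 3 * \<epsilon>" using bounds(2) \<epsilon> by linarith
      then show ?thesis using \<open>r > 0\<close> by (simp add: \<epsilon>_def)
    qed
    then show ?case by (simp add: I_def G_def x_def e_def)
  qed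
  then show "\<exists>N. \<forall>n\<ge>N. norm (inf_coverage n (\<lambda>y. thresholded_interval ivl (\<eta> n) (a n) (s n y) (sample_mean n y))
      - asymptotic_inf_coverage n (\<eta> n) (a n) - 0) < r"
    by (simp add: eventually_sequentially)
qed

theorem theorem9:
  fixes \<eta> a :: "nat \<Rightarrow> real"
  assumes "\<And>n. n \<ge> 2 \<Longrightarrow> \<eta> n > 0"
    and "\<eta> \<longlonglongrightarrow> 0"
    and "\<And>n. n \<ge> 2 \<Longrightarrow> a n \<ge> 0"
  shows "\<forall>ivl \<in> {atLeastAtMost, greaterThanLessThan, greaterThanAtMost, atLeastLessThan}.
    (\<lambda>n. inf_coverage n (interval_feasible ivl n (\<eta> n) (a n))
       - inf_coverage n (interval_known ivl n (\<eta> n) (a n))) \<longlonglongrightarrow> 0"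
proof
  fix ivl :: "real \<Rightarrow> real \<Rightarrow> real set" assume ivl: "ivl \<in> interval_kinds"
  have "(\<lambda>n. inf_coverage n (interval_feasible ivl n (\<eta> n) (a n)) - asymptotic_inf_coverage n (\<eta> n) (a n)) \<longlonglongrightarrow> 0"
    unfolding interval_feasible_eq[abs_def]
  proof (rule inf_coverage_asymptotics[OF assms ivl])
    fix \<epsilon> :: real assume \<epsilon>: "\<epsilon> > 0"
    define L where "L = max 1 (3 / \<epsilon>)"
    have L: "L \<ge> 1" "3 / L \<le> \<epsilon>" using \<epsilon> by (auto simp: L_def field_simps max_def)
    show "\<exists>K\<ge>0. \<forall>n\<ge>2. \<forall>\<theta>. \<P>(y in sample_law n \<theta>. \<bar>sample_sd n y - 1\<bar> > K / sqrt n) \<le> \<epsilon>"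
      using sample_sd_tight[OF _ L(1)] L by (intro exI[of _ "6 * L"]) (auto intro: order_trans)
  qed measurable
  moreover have "(\<lambda>n. inf_coverage n (interval_known ivl n (\<eta> n) (a n)) - asymptotic_inf_coverage n (\<eta> n) (a n)) \<longlonglongrightarrow> 0"
    unfolding interval_known_eq[abs_def]
    by (rule inf_coverage_asymptotics[OF assms ivl, where s = "\<lambda>_ _. 1"])
       (auto intro!: exI[of _ 0])
  ultimately show "(\<lambda>n. inf_coverage n (interval_feasible ivl n (\<eta> n) (a n))
       - inf_coverage n (interval_known ivl n (\<eta> n) (a n))) \<longlonglongrightarrow> 0"
    using tendsto_diff by fastforce
qed

end
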